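(* For $n\ge1$ let $G(n)$ be the number of ordinary partitions of $n$ into parts congruent to $\pm2,\pm3,\pm4,\pm5$ modulo $16$. Let $H(n)$ be the number of partitions of $n$ with $n$ copies of $n$ such that (i) every part $m_j$ has even subscript $j$, (ii) with parts in ascending lexicographic order, the weighted difference between each part and the preceding one is $\ge0$, and (iii) there is no pair of consecutive parts $a_i\le b_j$ (in this order) with $a$ and $b$ both odd and $((b_j-a_i))=0$. Then $G(n)=H(n)$.
   Context: $M=\{m_i: 1\le i\le m\}$; a partition with $n$ copies of $n$ is a finite multiset of elements of $M$ whose values (first entries) sum to the number partitioned. Lexicographic order: $m_i>n_j$ iff $m>n$, or $m=n$ and $i>j$. Weighted difference $((m_i-n_j))=m-n-i-j$. *)

theory Defs
  imports Main "HOL-Library.Multiset" "HOL-Library.Product_Lexorder"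
begin

definition G :: "nat \<Rightarrow> nat" where
  "G n = card {M :: nat multiset.
      (\<forall>p \<in># M. p > 0 \<and> p mod 16 \<in> {2,3,4,5,11,12,13,14}) \<and> sum_mset M = n}"

(* A part m_i of a partition with n copies of n is the pair (m, i), 1 <= i <= m.
   The linear order on nat \<times> nat from Product_Lexorder is the lexicographic
   order of the paper: m_i > n_j iff m > n, or m = n and i > j. *)

definition wdiff :: "nat \<times> nat \<Rightarrow> nat \<times> nat \<Rightarrow> int" where
  "wdiff p q = int (fst p) - int (fst q) - int (snd p) - int (snd q)"

definition H_cond :: "(nat \<times> nat) list \<Rightarrow> bool" where
  "H_cond xs \<longleftrightarrow> (\<forall>k. Suc k < length xs \<longrightarrow>
      wdiff (xs ! Suc k) (xs ! k) \<ge> 0 \<and>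
      \<not> (odd (fst (xs ! k)) \<and> odd (fst (xs ! Suc k)) \<and> wdiff (xs ! Suc k) (xs ! k) = 0))"

definition H :: "nat \<Rightarrow> nat" where
  "H n = card {M :: (nat \<times> nat) multiset.
      (\<forall>p \<in># M. 1 \<le> snd p \<and> snd p \<le> fst p \<and> even (snd p)) \<and>
      sum_mset (image_mset fst M) = n \<and>
      H_cond (sorted_list_of_multiset M)}"

end

theory Submission
  imports Defs "HOL-Computational_Algebra.Formal_Power_Series"
begin

unbundle fps_syntax

text \<open>
  A part \<open>m\<^sub>j\<close> with \<open>j\<close> even encodes the pair of odd numbers \<open>m - j + 1 < m + j - 1\<close> (\<open>m\<close> even) or
  \<open>m - j < m + j\<close> (\<open>m\<close> odd). The two difference conditions say exactly that the pairs of consecutive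
  parts do not interleave, so \<open>H n\<close> counts the sets of odd numbers with sum \<open>2 n\<close>: its generating
  function \<open>D\<close> is the even part of \<open>\<Prod> (1 + X\<^bsup>2i+1\<^esup>)\<close> with \<open>X\<^sup>2\<close> renamed to \<open>X\<close>.

  Multiplied by \<open>\<Prod> (1 - X\<^bsup>4i+4\<^esup>)\<close>, that product becomes the theta series with exponents \<open>2 l\<^sup>2 - l\<close> by the
  Jacobi triple product. Its even exponents are those with \<open>l\<close> even, and halving them gives the
  exponents \<open>4 l\<^sup>2 - l\<close> of another triple product. Hence
  \<open>D \<Prod> (1 - X\<^bsup>2i+2\<^esup>) = \<Prod> (1 + X\<^bsup>8i+3\<^esup>) (1 + X\<^bsup>8i+5\<^esup>) (1 - X\<^bsup>8i+8\<^esup>)\<close>. Multiplying by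
  \<open>\<Prod> (1 - X\<^bsup>8i+3\<^esup>) (1 - X\<^bsup>8i+5\<^esup>)\<close> and cancelling the factors with exponents \<open>0, 6, 8, 10\<close> modulo 16 leaves
  \<open>D \<Prod> (1 - X\<^sup>a) = 1\<close>, with \<open>a\<close> running through the parts admitted by \<open>G\<close>. Infinite products are
  replaced by finite ones, compared modulo \<open>X\<^sup>L\<close>.
\<close>

section \<open>Parts with copies as pairs of odd numbers\<close>

fun odd_pair_low :: "nat \<times> nat \<Rightarrow> nat" where
  "odd_pair_low (m, j) = (if even m then m + 1 - j else m - j)"

fun odd_pair_high :: "nat \<times> nat \<Rightarrow> nat" where
  "odd_pair_high (m, j) = (if even m then m + j - 1 else m + j)"

definition copy_part :: "nat \<times> nat \<Rightarrow> bool" where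
  "copy_part p \<longleftrightarrow> 1 \<le> snd p \<and> snd p \<le> fst p \<and> even (snd p)"

fun odd_pairs :: "(nat \<times> nat) list \<Rightarrow> nat list" where
  "odd_pairs [] = []"
| "odd_pairs (p # xs) = odd_pair_low p # odd_pair_high p # odd_pairs xs"

lemma odd_pair_low_less_high: "copy_part p \<Longrightarrow> odd_pair_low p < odd_pair_high p"
  by (cases p) (auto simp: copy_part_def)

lemma odd_odd_pair: "copy_part p \<Longrightarrow> odd (odd_pair_low p) \<and> odd (odd_pair_high p)"
  by (cases p) (auto simp: copy_part_def)

lemma odd_pair_sum: "copy_part p \<Longrightarrow> odd_pair_low p + odd_pair_high p = 2 * fst p"
  by (cases p) (auto simp: copy_part_def)

text \<open>The two odd numbers sum to \<open>2 * fst p\<close>, so they determine the value; its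
  parity selects the formula, which then yields the subscript.\<close>

lemma odd_pair_inject:
  assumes "copy_part p" "copy_part p'"
    and "odd_pair_low p = odd_pair_low p'" "odd_pair_high p = odd_pair_high p'"
  shows "p = p'"
proof -
  have "fst p = fst p'"
    using odd_pair_sum[OF assms(1)] odd_pair_sum[OF assms(2)] assms(3,4) by simp
  then show ?thesis
    using assms by (cases p; cases p') (auto simp: copy_part_def split: if_splits)
qed

lemma odd_pair_exists:
  assumes "odd a" "odd b" "a < b"
  shows "\<exists>p. copy_part p \<and> odd_pair_low p = a \<and> odd_pair_high p = b"
proof -
  obtain u d where a: "a = 2 * u + 1" and b: "b = a + 2 * d" and d: "d > 0"
  proof -
    obtain u v where "a = 2 * u + 1" "b = 2 * v + 1" using assms by (auto elim!: oddE)
    then show ?thesis using assms that[of u "v - u"] by auto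
  qed
  show ?thesis
    \<comment> \<open>The value is the mean of \<open>a\<close> and \<open>b\<close>. As
      \<open>a\<close> is odd, it is even exactly when \<open>d\<close> is odd, so the subscript is
      \<open>d\<close> rounded up to an even number.\<close>
    by (rule exI[of _ "(a + d, if odd d then d + 1 else d)"])
      (use d in \<open>auto simp: a b copy_part_def elim!: oddE\<close>)
qed

text \<open>As an integer, \<open>odd_pair_low p' - odd_pair_high p\<close> is
  \<open>wdiff p' p\<close> plus the number of even values among \<open>fst p\<close> and
  \<open>fst p'\<close>. If none is even, it is positive iff \<open>wdiff p' p > 0\<close>; if one
  is, iff \<open>wdiff p' p >= 0\<close>; if both are, \<open>wdiff p' p\<close> is even, and
  exceeding -2 again means being nonnegative.\<close>

lemma odd_pair_less_iff:
  assumes "copy_part p" "copy_part p'"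
  shows "odd_pair_high p < odd_pair_low p' \<longleftrightarrow>
    wdiff p' p \<ge> 0 \<and> \<not> (odd (fst p) \<and> odd (fst p') \<and> wdiff p' p = 0)"
proof -
  obtain m i m' i' where p: "p = (m, 2 * i)" "p' = (m', 2 * i')"
    using assms by (cases p; cases p') (auto simp: copy_part_def elim!: evenE)
  show ?thesis
    using assms unfolding p copy_part_def wdiff_def by (auto elim!: oddE evenE) presburger+
qed

lemma H_cond_Nil: "H_cond []"
  and H_cond_single: "H_cond [p]"
  by (simp_all add: H_cond_def)

lemma H_cond_Cons_Cons:
  "H_cond (p # p' # xs) \<longleftrightarrow>
    (wdiff p' p \<ge> 0 \<and> \<not> (odd (fst p) \<and> odd (fst p') \<and> wdiff p' p = 0)) \<and> H_cond (p' # xs)"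
  unfolding H_cond_def
  apply (rule iffI)
   apply (rule conjI)
  subgoal by (metis length_Cons nth_Cons_0 nth_Cons_Suc Suc_less_eq zero_less_Suc)
  subgoal by (metis length_Cons nth_Cons_Suc Suc_less_eq)
  subgoal by (auto simp: nth_Cons split: nat.splits)
  done

lemma sum_list_odd_pairs:
  "(\<forall>p\<in>set xs. copy_part p) \<Longrightarrow> sum_list (odd_pairs xs) = 2 * sum_list (map fst xs)"
  by (induction xs) (auto simp: odd_pair_sum simp flip: add.assoc)

lemma odd_in_odd_pairs: "(\<forall>p\<in>set xs. copy_part p) \<Longrightarrow> \<forall>y\<in>set (odd_pairs xs). odd y"
  by (induction xs) (auto simp: odd_odd_pair)

text \<open>The order inside each pair is automatic, so only the junctions between consecutive pairs
  matter, and those are governed by \<open>odd_pair_less_iff\<close>.\<close>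

lemma sorted_odd_pairs_iff:
  "(\<forall>p\<in>set xs. copy_part p) \<Longrightarrow> sorted_wrt (<) (odd_pairs xs) \<longleftrightarrow> H_cond xs"
proof (induction xs)
  case Nil
  then show ?case by (simp add: H_cond_Nil)
next
  case (Cons p xs)
  show ?case
  proof (cases xs)
    case Nil
    then show ?thesis using Cons.prems by (simp add: H_cond_single odd_pair_low_less_high)
  next
    case (Cons p' ys)
    have IH: "sorted_wrt (<) (odd_pairs xs) \<longleftrightarrow> H_cond xs"
      using Cons.IH Cons.prems by simp
    have "sorted_wrt (<) (odd_pairs (p # xs)) \<longleftrightarrow>
        odd_pair_high p < odd_pair_low p' \<and> sorted_wrt (<) (odd_pairs xs)"
      using Cons.prems odd_pair_low_less_high[of p] by (auto simp: Cons)
    also have "\<dots> \<longleftrightarrow> H_cond (p # xs)"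
      unfolding IH using Cons.prems by (simp add: Cons H_cond_Cons_Cons odd_pair_less_iff)
    finally show ?thesis .
  qed
qed

lemma odd_pairs_inject:
  assumes "\<forall>p\<in>set xs. copy_part p" "\<forall>p\<in>set ys. copy_part p" "odd_pairs xs = odd_pairs ys"
  shows "xs = ys"
  using assms
proof (induction xs arbitrary: ys)
  case Nil
  then show ?case by (cases ys) auto
next
  case (Cons p xs)
  then show ?case by (cases ys) (auto intro: odd_pair_inject)
qed

text \<open>An even sum of odd numbers has an even number of terms, so the list can be cut into
  consecutive pairs, each coming from a part.\<close>

lemma odd_pairs_exists:
  assumes "sorted_wrt (<) ys" "\<forall>y\<in>set ys. odd y" "even (sum_list ys)"
  shows "\<exists>xs. (\<forall>p\<in>set xs. copy_part p) \<and> odd_pairs xs = ys"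
  using assms
proof (induction ys rule: induct_list012)
  case 1
  show ?case by (rule exI[of _ "[]"]) simp
next
  case (2 y)
  then show ?case by simp
next
  case (3 a b ys)
  then obtain xs where "\<forall>p\<in>set xs. copy_part p" "odd_pairs xs = ys" by auto
  moreover obtain p where "copy_part p" "odd_pair_low p = a" "odd_pair_high p = b"
    using odd_pair_exists[of a b] 3 by auto
  ultimately show ?case by (intro exI[of _ "p # xs"]) simp
qed

text \<open>Subscripts are positive, so a nonnegative weighted difference makes the values strictly
  increase. Such a list is therefore the sorted list of its own multiset.\<close>

lemma H_cond_imp_sorted:
  "(\<forall>p\<in>set xs. copy_part p) \<Longrightarrow> H_cond xs \<Longrightarrow> sorted xs"
proof (induction xs rule: induct_list012)
  case (3 p p' xs)
  then have "p \<le> p'"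
    by (cases p; cases p') (auto simp: H_cond_Cons_Cons wdiff_def copy_part_def)
  then show ?case using 3 by (auto simp: H_cond_Cons_Cons)
qed auto

text \<open>Three bijections: from multisets of parts to their sorted lists \<open>XS\<close>, by
  \<open>odd_pairs\<close> to strictly increasing lists \<open>YS\<close> of odd numbers, and on to
  their sets. The sum doubles at the second one.\<close>

lemma H_eq_card_odd_sets: "H n = card {T. finite T \<and> (\<forall>t\<in>T. odd t) \<and> \<Sum>T = 2 * n}"
proof -
  define XS where "XS = {xs. (\<forall>p\<in>set xs. copy_part p) \<and> sum_list (map fst xs) = n \<and> H_cond xs}"
  define YS :: "nat list set"
    where "YS = {ys. sorted_wrt (<) ys \<and> (\<forall>y\<in>set ys. odd y) \<and> sum_list ys = 2 * n}"
  have "bij_betw mset XS {M. (\<forall>p \<in># M. 1 \<le> snd p \<and> snd p \<le> fst p \<and> even (snd p)) \<and>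
      sum_mset (image_mset fst M) = n \<and> H_cond (sorted_list_of_multiset M)}"
  proof (rule bij_betw_byWitness[where f' = sorted_list_of_multiset])
    have *: "sorted_list_of_multiset (mset xs) = xs" if "xs \<in> XS" for xs
      using that H_cond_imp_sorted[of xs] by (simp add: XS_def sorted_sort_id)
    then show "\<forall>xs\<in>XS. sorted_list_of_multiset (mset xs) = xs" by blast
    show "mset ` XS \<subseteq> {M. (\<forall>p \<in># M. 1 \<le> snd p \<and> snd p \<le> fst p \<and> even (snd p)) \<and>
      sum_mset (image_mset fst M) = n \<and> H_cond (sorted_list_of_multiset M)}"
    proof clarify
      fix xs assume xs: "xs \<in> XS"
      have "sum_mset (image_mset fst (mset xs)) = sum_list (map fst xs)"
        by (metis mset_map sum_mset_sum_list)
      then show "(\<forall>p \<in># mset xs. 1 \<le> snd p \<and> snd p \<le> fst p \<and> even (snd p)) \<and>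
        sum_mset (image_mset fst (mset xs)) = n \<and> H_cond (sorted_list_of_multiset (mset xs))"
        using xs unfolding *[OF xs] by (simp add: XS_def copy_part_def)
    qed
  next
    show "sorted_list_of_multiset ` {M. (\<forall>p \<in># M. 1 \<le> snd p \<and> snd p \<le> fst p \<and> even (snd p)) \<and>
      sum_mset (image_mset fst M) = n \<and> H_cond (sorted_list_of_multiset M)} \<subseteq> XS"
    proof clarify
      fix M :: "(nat \<times> nat) multiset"
      assume *: "\<forall>p \<in># M. 1 \<le> snd p \<and> snd p \<le> fst p \<and> even (snd p)"
        "H_cond (sorted_list_of_multiset M)" "n = sum_mset (image_mset fst M)"
      have "sum_list (map fst (sorted_list_of_multiset M)) = sum_mset (image_mset fst M)"
        by (metis mset_map mset_sorted_list_of_multiset sum_mset_sum_list)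
      then show "sorted_list_of_multiset M \<in> XS" using * by (simp add: XS_def copy_part_def)
    qed
  qed simp
  then have "H n = card XS" unfolding H_def by (simp add: bij_betw_same_card)
  also have "bij_betw odd_pairs XS YS"
  proof (rule bij_betwI')
    show "odd_pairs xs = odd_pairs ys \<longleftrightarrow> xs = ys" if "xs \<in> XS" "ys \<in> XS" for xs ys
      using that odd_pairs_inject[of xs ys] by (auto simp: XS_def)
    show "odd_pairs xs \<in> YS" if "xs \<in> XS" for xs
      using that sum_list_odd_pairs[of xs] odd_in_odd_pairs[of xs] sorted_odd_pairs_iff[of xs]
      by (simp add: XS_def YS_def)
    show "\<exists>xs\<in>XS. ys = odd_pairs xs" if ys: "ys \<in> YS" for ys
    proof -
      obtain xs where "\<forall>p\<in>set xs. copy_part p" "odd_pairs xs = ys"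
        using odd_pairs_exists[of ys] ys by (auto simp: YS_def)
      then show ?thesis
        using ys sum_list_odd_pairs[of xs] sorted_odd_pairs_iff[of xs]
        by (intro bexI[of _ xs]) (auto simp: XS_def YS_def)
    qed
  qed
  then have "card XS = card YS" by (rule bij_betw_same_card)
  also have "bij_betw set YS {T. finite T \<and> (\<forall>t\<in>T. odd t) \<and> \<Sum>T = 2 * n}"
  proof (rule bij_betw_byWitness[where f' = sorted_list_of_set])
    have sum: "sum_list ys = \<Sum>(set ys)" if "distinct ys" for ys :: "nat list"
      using sum_list_distinct_conv_sum_set[OF that, of "\<lambda>x. x"] by simp
    show "\<forall>ys\<in>YS. sorted_list_of_set (set ys) = ys"
      by (simp add: YS_def strict_sorted_iff sorted_list_of_set.idem_if_sorted_distinct)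
    show "set ` YS \<subseteq> {T. finite T \<and> (\<forall>t\<in>T. odd t) \<and> \<Sum>T = 2 * n}"
      by (clarsimp simp: YS_def strict_sorted_iff) (simp flip: sum)
    show "sorted_list_of_set ` {T. finite T \<and> (\<forall>t\<in>T. odd t) \<and> \<Sum>T = 2 * n} \<subseteq> YS"
      by (clarsimp simp: YS_def sum)
  qed simp
  then have "card YS = card {T. finite T \<and> (\<forall>t\<in>T. odd t) \<and> \<Sum>T = 2 * n}"
    by (rule bij_betw_same_card)
  finally show ?thesis .
qed

section \<open>Power series modulo a power of the variable\<close>

text \<open>Divisibility makes compatibility with products a ring computation;
  \<open>fps_cong_iff_nth\<close> turns it into agreement of the first \<open>L\<close>
  coefficients.\<close>

definition fps_cong :: "nat \<Rightarrow> int fps \<Rightarrow> int fps \<Rightarrow> bool" where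
  "fps_cong L f g \<longleftrightarrow> fps_X ^ L dvd f - g"

lemma fps_cong_iff_nth: "fps_cong L f g \<longleftrightarrow> (\<forall>i<L. f $ i = g $ i)"
proof
  assume "fps_cong L f g"
  then obtain h where "f - g = fps_X ^ L * h" by (auto simp: fps_cong_def)
  then have "(f - g) $ i = 0" if "i < L" for i
    using that by (simp only: fps_X_power_mult_nth) simp
  then show "\<forall>i<L. f $ i = g $ i" by simp
next
  assume *: "\<forall>i<L. f $ i = g $ i"
  have "f - g = fps_X ^ L * fps_shift L (f - g)"
    by (rule fps_ext) (use * in \<open>simp add: fps_X_power_mult_nth\<close>)
  then show "fps_cong L f g" unfolding fps_cong_def by (rule dvdI)
qed

lemma fps_cong_refl [simp, intro]: "fps_cong L f f"
  by (simp add: fps_cong_iff_nth)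

lemma fps_cong_sym: "fps_cong L f g \<Longrightarrow> fps_cong L g f"
  by (simp add: fps_cong_iff_nth)

lemma fps_cong_trans [trans]: "fps_cong L f g \<Longrightarrow> fps_cong L g h \<Longrightarrow> fps_cong L f h"
  by (simp add: fps_cong_iff_nth)

lemma fps_cong_mult:
  assumes "fps_cong L f g" "fps_cong L f' g'"
  shows "fps_cong L (f * f') (g * g')"
proof -
  have "f * f' - g * g' = (f - g) * f' + g * (f' - g')" by (simp add: algebra_simps)
  then show ?thesis using assms by (simp add: fps_cong_def)
qed

lemma fps_cong_sum: "(\<And>i. i \<in> A \<Longrightarrow> fps_cong L (f i) (g i)) \<Longrightarrow> fps_cong L (sum f A) (sum g A)"
  by (induction A rule: infinite_finite_induct) (auto simp: fps_cong_iff_nth)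

lemma fps_cong_prod: "(\<And>i. i \<in> A \<Longrightarrow> fps_cong L (f i) (g i)) \<Longrightarrow> fps_cong L (prod f A) (prod g A)"
  by (induction A rule: infinite_finite_induct) (auto intro: fps_cong_mult)

text \<open>A series with constant term 1 is a unit, even over the integers.\<close>

lemma fps_cong_cancel:
  assumes "fps_cong L (f * h) (g * h)" "h $ 0 = 1"
  shows "fps_cong L f g"
proof -
  have h: "h * fps_right_inverse h 1 = 1"
    using assms(2) by (intro fps_right_inverse) simp
  have "fps_cong L (f * h * fps_right_inverse h 1) (g * h * fps_right_inverse h 1)"
    by (intro fps_cong_mult assms fps_cong_refl)
  then show ?thesis by (simp add: mult.assoc h)
qed

lemma fps_cong_X_power_mult_0: "L \<le> e \<Longrightarrow> fps_cong L (fps_X ^ e * f) 0"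
  by (simp add: fps_cong_def le_imp_power_dvd dvd_mult2)

section \<open>The Jacobi triple product\<close>

text \<open>The q-Pascal rule serves as definition, so that no division is required of the
  ring.\<close>

fun gauss_binomial :: "'a::comm_ring_1 \<Rightarrow> nat \<Rightarrow> nat \<Rightarrow> 'a" where
  "gauss_binomial q N 0 = 1"
| "gauss_binomial q 0 (Suc k) = 0"
| "gauss_binomial q (Suc N) (Suc k) = gauss_binomial q N k + q ^ Suc k * gauss_binomial q N (Suc k)"

lemma gauss_binomial_eq_0: "N < k \<Longrightarrow> gauss_binomial q N k = 0"
  by (induction q N k rule: gauss_binomial.induct) auto

lemma gauss_binomial_self: "gauss_binomial q N N = 1"
  by (induction N) (auto simp: gauss_binomial_eq_0)

text \<open>This is the q-Pochhammer symbol (q; q)_n.\<close>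

definition q_fact :: "'a::comm_ring_1 \<Rightarrow> nat \<Rightarrow> 'a" where
  "q_fact q n = (\<Prod>i<n. 1 - q ^ Suc i)"

lemma q_fact_Suc: "q_fact q (Suc n) = q_fact q n * (1 - q ^ Suc n)"
  by (simp add: q_fact_def)

text \<open>The quotient formula with denominators cleared. The two terms of the q-Pascal rule
  contribute the factors \<open>1 - q ^ k\<close> and \<open>q ^ k * (1 - q ^ j)\<close>, which add
  up to \<open>1 - q ^ (k + j)\<close>.\<close>

lemma gauss_binomial_q_fact:
  "gauss_binomial q (k + j) k * q_fact q k * q_fact q j = q_fact q (k + j)"
proof (induction "k + j" arbitrary: k j)
  case 0
  then show ?case by (simp add: q_fact_def)
next
  case (Suc N)
  show ?case
  proof (cases k)
    case 0
    then show ?thesis by (simp add: q_fact_def)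
  next
    case k: (Suc k')
    show ?thesis
    proof (cases j)
      case 0
      then show ?thesis by (simp add: gauss_binomial_self q_fact_def)
    next
      case j: (Suc j')
      have N: "N = k' + j" "N = k + j'" using Suc.hyps(2) k j by auto
      have 1: "gauss_binomial q N k' * q_fact q k' * q_fact q j = q_fact q N"
        using Suc.hyps(1)[OF N(1)] N(1) by simp
      have 2: "gauss_binomial q N k * q_fact q k * q_fact q j' = q_fact q N"
        using Suc.hyps(1)[OF N(2)] N(2) by simp
      have "gauss_binomial q (k + j) k * q_fact q k * q_fact q j
          = (gauss_binomial q N k' * q_fact q k' * q_fact q j) * (1 - q ^ k)
            + q ^ k * (gauss_binomial q N k * q_fact q k * q_fact q j') * (1 - q ^ j)"
        using Suc.hyps(2)[symmetric] by (simp add: k j q_fact_Suc algebra_simps)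
      also have "\<dots> = q_fact q N * (1 - q ^ (k + j))"
        unfolding 1 2 by (simp add: algebra_simps power_add)
      also have "\<dots> = q_fact q (k + j)"
        using Suc.hyps(2)[symmetric] by (simp add: q_fact_Suc)
      finally show ?thesis .
    qed
  qed
qed

text \<open>Induction with \<open>x\<close> arbitrary: once the factor for \<open>i = 0\<close> is
  split off, the others form the same product at \<open>x * q\<close>. The homogeneous form in
  \<open>x\<close> and \<open>y\<close> avoids negative powers later.\<close>

lemma gauss_binomial_theorem:
  fixes x y q :: "'a::comm_ring_1"
  shows "(\<Prod>i<N. y + x * q ^ i) =
    (\<Sum>k\<le>N. q ^ (k choose 2) * gauss_binomial q N k * x ^ k * y ^ (N - k))"
proof (induction N arbitrary: x)
  case 0
  then show ?case by (simp add: numeral_2_eq_2)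
next
  case (Suc N)
  define t where "t = (\<lambda>k. q ^ (k choose 2) * x ^ k)"
  define b where "b = gauss_binomial q"
  have "(\<Prod>i<Suc N. y + x * q ^ i) = (y + x) * (\<Prod>i<N. y + (x * q) * q ^ i)"
    by (simp add: prod.lessThan_Suc_shift mult.assoc del: prod.lessThan_Suc)
  also have "(\<Prod>i<N. y + (x * q) * q ^ i)
     = (\<Sum>k\<le>N. t k * q ^ k * b N k * y ^ (N - k))"
    unfolding Suc.IH by (intro sum.cong) (simp_all add: t_def b_def power_mult_distrib mult_ac)
  also have "(y + x) * \<dots> = (\<Sum>k\<le>N. t k * q ^ k * b N k * y ^ (Suc N - k))
      + (\<Sum>k\<le>N. t (Suc k) * b N k * y ^ (N - k))"
  proof -
    have "y * (\<Sum>k\<le>N. t k * q ^ k * b N k * y ^ (N - k))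
        = (\<Sum>k\<le>N. t k * q ^ k * b N k * y ^ (Suc N - k))"
      unfolding sum_distrib_left by (intro sum.cong) (simp_all add: Suc_diff_le mult_ac)
    moreover have "x * (\<Sum>k\<le>N. t k * q ^ k * b N k * y ^ (N - k))
        = (\<Sum>k\<le>N. t (Suc k) * b N k * y ^ (N - k))"
      unfolding sum_distrib_left
      by (intro sum.cong) (simp_all add: t_def numeral_2_eq_2 power_add mult_ac)
    ultimately show ?thesis by (simp add: distrib_right)
  qed
  \<comment> \<open>The added term at \<open>k = Suc N\<close> is zero; it aligns this sum with the
    shifted one, so that the q-Pascal rule applies termwise.\<close>
  also have "(\<Sum>k\<le>N. t k * q ^ k * b N k * y ^ (Suc N - k))
      = (\<Sum>k\<le>Suc N. t k * q ^ k * b N k * y ^ (Suc N - k))"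
    by (simp add: b_def gauss_binomial_eq_0)
  also have "\<dots> = y ^ Suc N + (\<Sum>k\<le>N. t (Suc k) * q ^ Suc k * b N (Suc k) * y ^ (N - k))"
    by (subst sum.atMost_Suc_shift) (simp add: t_def b_def numeral_2_eq_2)
  also have "y ^ Suc N + (\<Sum>k\<le>N. t (Suc k) * q ^ Suc k * b N (Suc k) * y ^ (N - k))
      + (\<Sum>k\<le>N. t (Suc k) * b N k * y ^ (N - k))
      = y ^ Suc N + (\<Sum>k\<le>N. t (Suc k) * b (Suc N) (Suc k) * y ^ (N - k))"
    by (simp add: b_def sum.distrib[symmetric] algebra_simps)
  also have "\<dots> = (\<Sum>k\<le>Suc N. t k * b (Suc N) k * y ^ (Suc N - k))"
    by (subst sum.atMost_Suc_shift) (simp add: t_def b_def numeral_2_eq_2)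
  finally show ?case by (simp add: t_def b_def mult_ac)
qed

text \<open>The quotient is the binomial coefficient of \<open>l\<close> over 2, for negative
  \<open>l\<close> as well. \<open>theta_exp 1 4 l\<close> is 2 l^2 - l and
  \<open>theta_exp 3 8 l\<close> is 4 l^2 - l; by \<open>theta_exp_int\<close>, \<open>nat\<close>
  truncates nothing when \<open>a \<le> s\<close>.\<close>

definition theta_exp :: "nat \<Rightarrow> nat \<Rightarrow> int \<Rightarrow> nat" where
  "theta_exp a s l = nat (int a * l + int s * (l * (l - 1) div 2))"

lemma two_int_choose_two: "2 * int (m choose 2) = int m * (int m - 1)"
proof -
  have "2 * (m choose 2) = m * (m - 1)"
    by (cases m) (simp_all add: choose_two)
  then have "2 * int (m choose 2) = int (m * (m - 1))"
    by (metis of_nat_mult of_nat_numeral)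
  then show ?thesis by (cases m) (simp_all add: algebra_simps)
qed

lemma theta_exp_int:
  assumes "a \<le> s"
  shows "int (theta_exp a s l) = int a * l + int s * (l * (l - 1) div 2)"
proof -
  have "0 \<le> int a * l + int s * (l * (l - 1) div 2)"
  proof (cases "0 \<le> l")
    case True
    then have "0 \<le> l * (l - 1)" by (cases "l = 0") auto
    then show ?thesis using True by simp
  next
    case False
    then have "2 * (- l) \<le> (1 - l) * (- l)" by (intro mult_right_mono) auto
    then have "- l \<le> l * (l - 1) div 2" by (simp add: algebra_simps)
    then have "int s * (- l) \<le> int s * (l * (l - 1) div 2)" by (intro mult_left_mono) auto
    moreover have "int a * (- l) \<le> int s * (- l)" using assms False by (intro mult_right_mono) auto
    ultimately show ?thesis by simp
  qed
  then show ?thesis by (simp add: theta_exp_def)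
qed

lemma two_theta_exp:
  assumes "a \<le> s"
  shows "2 * int (theta_exp a s l) = 2 * int a * l + int s * (l * (l - 1))"
proof -
  have "2 * (l * (l - 1) div 2) = l * (l - 1)" by simp
  then have "int s * (2 * (l * (l - 1) div 2)) = int s * (l * (l - 1))" by (rule arg_cong)
  then show ?thesis by (simp only: theta_exp_int[OF assms]) (simp add: algebra_simps)
qed

text \<open>This bound discards all terms with \<open>\<bar>l\<bar> \<ge> L\<close> modulo
  \<open>X^L\<close>.\<close>

lemma abs_le_theta_exp:
  assumes "0 < a" "a < s"
  shows "\<bar>l\<bar> \<le> int (theta_exp a s l)"
proof (cases "0 \<le> l")
  case True
  then have "0 \<le> l * (l - 1)" by (cases "l = 0") auto
  then have "0 \<le> int s * (l * (l - 1))" by simp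
  moreover have "1 * l \<le> int a * l" using assms True by (intro mult_right_mono) auto
  ultimately show ?thesis using two_theta_exp[of a s l] assms True by simp
next
  case False
  then have "2 * (- l) \<le> (1 - l) * (- l)" by (intro mult_right_mono) auto
  then have "int s * (2 * (- l)) \<le> int s * (l * (l - 1))"
    by (intro mult_left_mono) (auto simp: algebra_simps)
  moreover have "1 * (- l) \<le> (int s - int a) * (- l)" using assms False by (intro mult_right_mono) auto
  ultimately show ?thesis using two_theta_exp[of a s l] assms False by (simp add: algebra_simps)
qed

text \<open>
  The Gauss binomial theorem with \<open>2 n\<close> factors, \<open>q = X\<^sup>s\<close>, \<open>x = X\<^sup>a\<close> and \<open>y = q\<^sup>n\<close>; the common factor
  \<open>X\<^sup>E\<close> clears the negative powers of the usual substitution \<open>x = X\<^sup>a q\<^bsup>-n\<^esup>\<close>.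
\<close>

lemma jacobi_triple_product_finite:
  fixes a s n :: nat
  assumes "0 < a" "a < s"
  shows "(\<Prod>i<n. (1 + fps_X ^ (s * i + a)) * (1 + fps_X ^ (s * i + (s - a)))) =
    (\<Sum>k\<le>2 * n. fps_X ^ theta_exp a s (int k - int n) * gauss_binomial (fps_X ^ s) (2 * n) k :: int fps)"
proof -
  define E where "E = a * n + s * (n choose 2) + s * n * n"
  define X :: "int fps" where "X = fps_X"
  \<comment> \<open>In these factors \<open>a + s * i\<close> is the smaller exponent. Pulling it
    out leaves \<open>s * (n - Suc i) + (s - a)\<close>, which is the second progression traversed
    backwards.\<close>
  have low: "(\<Prod>i<n. X ^ (s * n) + X ^ a * (X ^ s) ^ i) =
      X ^ (a * n + s * (n choose 2)) * (\<Prod>i<n. 1 + X ^ (s * i + (s - a)))"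
  proof -
    have "(\<Prod>i<n. X ^ (s * n) + X ^ a * (X ^ s) ^ i)
        = (\<Prod>i<n. X ^ (a + s * i) * (1 + X ^ (s * (n - Suc i) + (s - a))))"
    proof (intro prod.cong refl)
      fix i assume "i \<in> {..<n}"
      then obtain d where "n = Suc (i + d)" by (auto simp: less_iff_Suc_add)
      then have "s * n = (a + s * i) + (s * (n - Suc i) + (s - a))"
        using assms by (simp add: algebra_simps)
      then have "X ^ (s * n) = X ^ (a + s * i) * X ^ (s * (n - Suc i) + (s - a))"
        by (simp only: power_add)
      then show "X ^ (s * n) + X ^ a * (X ^ s) ^ i
          = X ^ (a + s * i) * (1 + X ^ (s * (n - Suc i) + (s - a)))"
        by (simp add: power_add power_mult distrib_left)
    qed
    also have "\<dots> = (\<Prod>i<n. X ^ (a + s * i)) * (\<Prod>i<n. 1 + X ^ (s * (n - Suc i) + (s - a)))"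
      by (rule prod.distrib)
    also have "(\<Prod>i<n. X ^ (a + s * i)) = X ^ (a * n + s * (n choose 2))"
      by (induction n) (simp_all add: power_add[symmetric] algebra_simps numeral_2_eq_2)
    also have "(\<Prod>i<n. 1 + X ^ (s * (n - Suc i) + (s - a))) = (\<Prod>i<n. 1 + X ^ (s * i + (s - a)))"
      by (rule prod.nat_diff_reindex)
    finally show ?thesis .
  qed
  \<comment> \<open>Here \<open>s * n\<close> is the smaller exponent, and the first progression
    remains.\<close>
  have high: "(\<Prod>i<n. X ^ (s * n) + X ^ a * (X ^ s) ^ (n + i)) =
      X ^ (s * n * n) * (\<Prod>i<n. 1 + X ^ (s * i + a))"
  proof -
    have "(\<Prod>i<n. X ^ (s * n) + X ^ a * (X ^ s) ^ (n + i))
        = (\<Prod>i<n. X ^ (s * n) * (1 + X ^ (s * i + a)))"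
      by (intro prod.cong refl) (simp add: power_add[symmetric] power_mult[symmetric] algebra_simps)
    then show ?thesis by (simp add: prod.distrib power_mult)
  qed
  have "X ^ E * (\<Prod>i<n. (1 + X ^ (s * i + a)) * (1 + X ^ (s * i + (s - a))))
      = (\<Prod>i<n. X ^ (s * n) + X ^ a * (X ^ s) ^ i) * (\<Prod>i<n. X ^ (s * n) + X ^ a * (X ^ s) ^ (n + i))"
    unfolding low high E_def by (simp add: prod.distrib power_add mult_ac)
  also have "\<dots> = (\<Prod>i<2 * n. X ^ (s * n) + X ^ a * (X ^ s) ^ i)"
  proof -
    have "(\<Prod>i<n. f i) * (\<Prod>i<m. f (n + i)) = (\<Prod>i<n + m. f i)" for f :: "nat \<Rightarrow> int fps" and m
      by (induction m) (simp_all add: mult.assoc[symmetric])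
    then show ?thesis by (simp add: mult_2)
  qed
  also have "\<dots> = (\<Sum>k\<le>2 * n. (X ^ s) ^ (k choose 2) * gauss_binomial (X ^ s) (2 * n) k
      * (X ^ a) ^ k * (X ^ (s * n)) ^ (2 * n - k))"
    by (rule gauss_binomial_theorem)
  also have "\<dots> = (\<Sum>k\<le>2 * n. X ^ E * (X ^ theta_exp a s (int k - int n) * gauss_binomial (X ^ s) (2 * n) k))"
  proof (intro sum.cong refl)
    fix k assume "k \<in> {..2 * n}"
    then have k: "k \<le> 2 * n" by simp
    have d: "int (2 * n - k) = 2 * int n - int k" using k by simp
    \<comment> \<open>Exponents are compared after doubling, which turns the binomials and
      \<open>theta_exp\<close> into polynomials.\<close>
    have "2 * int (s * (k choose 2) + a * k + s * n * (2 * n - k))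
        = int s * (2 * int (k choose 2)) + 2 * int a * int k + 2 * int s * int n * (2 * int n - int k)"
      unfolding of_nat_add of_nat_mult d by (simp add: algebra_simps)
    also have "\<dots> = 2 * int a * int n + int s * (2 * int (n choose 2)) + 2 * int s * int n * int n
        + 2 * int (theta_exp a s (int k - int n))"
      unfolding two_int_choose_two two_theta_exp[OF less_imp_le[OF assms(2)]]
      by (simp add: algebra_simps)
    also have "\<dots> = 2 * int (E + theta_exp a s (int k - int n))"
      by (simp add: E_def algebra_simps)
    finally have "s * (k choose 2) + a * k + s * n * (2 * n - k) = E + theta_exp a s (int k - int n)"
      by (simp only: mult_cancel_left of_nat_eq_iff) simp
    then have "X ^ (s * (k choose 2)) * X ^ (a * k) * X ^ (s * n * (2 * n - k))
        = X ^ E * X ^ theta_exp a s (int k - int n)"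
      by (simp only: power_add[symmetric])
    then show "(X ^ s) ^ (k choose 2) * gauss_binomial (X ^ s) (2 * n) k * (X ^ a) ^ k
        * (X ^ (s * n)) ^ (2 * n - k) =
      X ^ E * (X ^ theta_exp a s (int k - int n) * gauss_binomial (X ^ s) (2 * n) k)"
      by (simp add: power_mult[symmetric] mult_ac)
  qed
  also have "\<dots> = X ^ E * (\<Sum>k\<le>2 * n. X ^ theta_exp a s (int k - int n) * gauss_binomial (X ^ s) (2 * n) k)"
    by (simp add: sum_distrib_left)
  finally show ?thesis
    by (simp add: X_def)
qed

section \<open>From the finite triple product to its limit modulo \<open>X^L\<close>\<close>

lemma q_fact_nth_0: "0 < s \<Longrightarrow> q_fact (fps_X ^ s :: int fps) n $ 0 = 1"
  by (induction n) (simp_all add: q_fact_def fps_X_power_nth flip: power_mult power_add)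

lemma q_fact_cong:
  assumes "0 < s" "L \<le> m" "L \<le> n"
  shows "fps_cong L (q_fact (fps_X ^ s) m) (q_fact (fps_X ^ s) n)"
proof -
  have "fps_cong L (q_fact (fps_X ^ s) (L + d)) (q_fact (fps_X ^ s) L)" for d
  proof (induction d)
    case (Suc d)
    have "L \<le> s * Suc (L + d)" using assms(1) by (cases s) auto
    then have "fps_cong L (1 - (fps_X ^ s) ^ Suc (L + d)) 1"
      unfolding power_mult[symmetric] by (simp add: fps_cong_iff_nth fps_X_power_nth)
    with Suc have "fps_cong L (q_fact (fps_X ^ s) (L + d) * (1 - (fps_X ^ s) ^ Suc (L + d)))
        (q_fact (fps_X ^ s) L * 1)"
      by (intro fps_cong_mult)
    then show ?case by (simp add: q_fact_Suc)
  qed simp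
  then show ?thesis
    using assms(2,3) by (metis fps_cong_sym fps_cong_trans le_add_diff_inverse)
qed

text \<open>The Gauss binomial tends to the inverse of the infinite q-Pochhammer product. By
  \<open>q_fact_cong\<close>, all of \<open>Q k\<close>, \<open>Q j\<close>, \<open>Q n\<close> and
  \<open>Q (k + j)\<close> agree modulo \<open>X^L\<close>, so the quotient formula leaves one
  \<open>Q n\<close> to cancel.\<close>

lemma gauss_binomial_mult_q_fact_cong:
  assumes "0 < s" "L \<le> k" "L \<le> j" "L \<le> n"
  shows "fps_cong L (gauss_binomial (fps_X ^ s) (k + j) k * q_fact (fps_X ^ s) n) 1"
proof -
  define Q :: "nat \<Rightarrow> int fps" where "Q = q_fact (fps_X ^ s)"
  define b :: "int fps" where "b = gauss_binomial (fps_X ^ s) (k + j) k"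
  have "fps_cong L (b * Q n * Q n) (b * Q k * Q j)"
    unfolding Q_def by (intro fps_cong_mult fps_cong_refl q_fact_cong assms)
  also have "b * Q k * Q j = Q (k + j)"
    unfolding b_def Q_def by (rule gauss_binomial_q_fact)
  also have "fps_cong L (Q (k + j)) (1 * Q n)"
    unfolding Q_def mult_1 using assms by (intro q_fact_cong) auto
  finally show ?thesis
    unfolding b_def Q_def by (rule fps_cong_cancel) (simp add: q_fact_nth_0 assms)
qed

text \<open>Terms with \<open>k\<close> at distance at least \<open>L\<close> from \<open>n\<close>
  vanish on both sides. For the others, \<open>2 * L \<le> n\<close> keeps \<open>k\<close> and
  \<open>2 * n - k\<close> at least \<open>L\<close>, so the Gauss binomial cancels against
  \<open>q_fact\<close>.\<close>

lemma jacobi_triple_product_cong: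
  fixes a s n L :: nat
  assumes "0 < a" "a < s" "2 * L \<le> n"
  shows "fps_cong L
    ((\<Prod>i<n. (1 + fps_X ^ (s * i + a)) * (1 + fps_X ^ (s * i + (s - a)))) * q_fact (fps_X ^ s) n)
    (\<Sum>l\<in>{- int n..int n}. fps_X ^ theta_exp a s l)"
proof -
  have "fps_cong L
    (\<Sum>k\<le>2 * n. fps_X ^ theta_exp a s (int k - int n)
       * (gauss_binomial (fps_X ^ s) (2 * n) k * q_fact (fps_X ^ s) n))
    (\<Sum>k\<le>2 * n. fps_X ^ theta_exp a s (int k - int n) * 1)"
  proof (rule fps_cong_sum)
    fix k assume "k \<in> {..2 * n}"
    then have k: "k \<le> 2 * n" by simp
    show "fps_cong L (fps_X ^ theta_exp a s (int k - int n)
       * (gauss_binomial (fps_X ^ s) (2 * n) k * q_fact (fps_X ^ s) n))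
       (fps_X ^ theta_exp a s (int k - int n) * 1)"
    proof (cases "\<bar>int k - int n\<bar> < int L")
      case True
      have "fps_cong L (gauss_binomial (fps_X ^ s) (k + (2 * n - k)) k * q_fact (fps_X ^ s) n) 1"
        using True assms by (intro gauss_binomial_mult_q_fact_cong) linarith+
      then show ?thesis using k by (intro fps_cong_mult fps_cong_refl) simp
    next
      case False
      then have "L \<le> theta_exp a s (int k - int n)"
        using abs_le_theta_exp[OF assms(1,2), of "int k - int n"] by linarith
      then show ?thesis
        by (meson fps_cong_X_power_mult_0 fps_cong_sym fps_cong_trans)
    qed
  qed
  also have "(\<Sum>k\<le>2 * n. fps_X ^ theta_exp a s (int k - int n) * 1 :: int fps)
      = (\<Sum>l\<in>{- int n..int n}. fps_X ^ theta_exp a s l)"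
    by (rule sum.reindex_bij_witness[of _ "\<lambda>l. nat (l + int n)" "\<lambda>k. int k - int n"]) auto
  finally show ?thesis
    unfolding jacobi_triple_product_finite[OF assms(1,2)] by (simp add: sum_distrib_right mult.assoc)
qed

section \<open>Products over sets of exponents\<close>

definition prod_plus :: "nat set \<Rightarrow> int fps" where
  "prod_plus S = (\<Prod>i\<in>S. 1 + fps_X ^ i)"

definition prod_minus :: "nat set \<Rightarrow> int fps" where
  "prod_minus S = (\<Prod>i\<in>S. 1 - fps_X ^ i)"

text \<open>Both products are congruent to their restrictions to indices below \<open>L\<close>, and
  these coincide.\<close>

lemma fps_cong_prod_agree:
  assumes "finite S" "finite T" "\<And>i. i < L \<Longrightarrow> i \<in> S \<longleftrightarrow> i \<in> T"
    and "\<And>i. L \<le> i \<Longrightarrow> fps_cong L (f i) 1"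
  shows "fps_cong L (prod f S) (prod f T)"
proof -
  have *: "fps_cong L (prod f R) (prod f (R \<inter> {..<L}))" if "finite R" for R
  proof -
    have "prod f R = prod f (R \<inter> {..<L}) * prod f (R - {..<L})"
      using that by (simp add: prod.Int_Diff[of R f "{..<L}"])
    moreover have "fps_cong L (prod f (R - {..<L})) (prod (\<lambda>_. 1) (R - {..<L}))"
      by (rule fps_cong_prod) (use assms(4) in auto)
    ultimately show ?thesis
      using fps_cong_mult[OF fps_cong_refl, of L "prod f (R - {..<L})" 1 "prod f (R \<inter> {..<L})"] by simp
  qed
  have "S \<inter> {..<L} = T \<inter> {..<L}" using assms(3) by auto
  then show ?thesis using *[OF assms(1)] *[OF assms(2)] by (metis fps_cong_sym fps_cong_trans)
qed

lemma prod_plus_cong: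
  assumes "finite S" "finite T" "\<And>i. i < L \<Longrightarrow> i \<in> S \<longleftrightarrow> i \<in> T"
  shows "fps_cong L (prod_plus S) (prod_plus T)"
  unfolding prod_plus_def
  by (rule fps_cong_prod_agree[OF assms]) (auto simp: fps_cong_iff_nth fps_X_power_nth)

lemma prod_minus_cong:
  assumes "finite S" "finite T" "\<And>i. i < L \<Longrightarrow> i \<in> S \<longleftrightarrow> i \<in> T"
  shows "fps_cong L (prod_minus S) (prod_minus T)"
  unfolding prod_minus_def
  by (rule fps_cong_prod_agree[OF assms]) (auto simp: fps_cong_iff_nth fps_X_power_nth)

lemma prod_minus_nth_0: "0 \<notin> S \<Longrightarrow> prod_minus S $ 0 = 1"
  unfolding prod_minus_def
  by (induction S rule: infinite_finite_induct) (auto simp: fps_X_power_nth)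

lemma prod_plus_mult_prod_minus: "prod_plus S * prod_minus S = prod_minus ((*) 2 ` S)"
  unfolding prod_plus_def prod_minus_def
  by (subst prod.reindex)
    (simp_all add: inj_on_def prod.distrib[symmetric] algebra_simps power_add[symmetric] mult_2_right)

lemma prod_minus_Un:
  "finite S \<Longrightarrow> finite T \<Longrightarrow> S \<inter> T = {} \<Longrightarrow> prod_minus (S \<union> T) = prod_minus S * prod_minus T"
  unfolding prod_minus_def by (rule prod.union_disjoint)

lemma prod_plus_nth:
  assumes "finite S"
  shows "prod_plus S $ n = int (card {T. T \<subseteq> S \<and> \<Sum>T = n})"
proof -
  have "prod_plus S = (\<Sum>T\<in>Pow S. \<Prod>i\<in>T. fps_X ^ i)"
    unfolding prod_plus_def using assms by (subst add.commute) (simp add: prod_add)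
  also have "\<dots> = (\<Sum>T\<in>Pow S. fps_X ^ \<Sum>T)"
    by (simp add: power_sum)
  finally have "prod_plus S $ n = (\<Sum>T\<in>Pow S. if \<Sum>T = n then 1 else 0)"
    by (auto simp: fps_sum_nth fps_X_power_nth intro!: sum.cong)
  also have "\<dots> = int (card {T \<in> Pow S. \<Sum>T = n})"
    using assms by (simp add: sum.If_cases Int_def)
  finally show ?thesis by simp
qed

section \<open>Partitions with parts in a finite set\<close>

definition partition_fps :: "nat set \<Rightarrow> int fps" where
  "partition_fps S = Abs_fps (\<lambda>n. int (card {M. set_mset M \<subseteq> S \<and> sum_mset M = n}))"

lemma finite_partitions:
  assumes "finite S" "0 \<notin> S"
  shows "finite {M :: nat multiset. set_mset M \<subseteq> S \<and> sum_mset M = n}"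
proof (rule finite_subset)
  show "{M. set_mset M \<subseteq> S \<and> sum_mset M = n} \<subseteq> (\<Union>k\<le>n. multisets_of_size S k)"
  proof (clarsimp simp: multisets_of_size_def)
    fix M assume M: "set_mset M \<subseteq> S"
    then show "size M \<le> sum_mset M"
    proof (induction M)
      case (add x M)
      then have "0 < x" using assms(2) by (cases x) auto
      then show ?case using add by auto
    qed simp
  qed
  show "finite (\<Union>k\<le>n. multisets_of_size S k)"
    using assms(1) by auto
qed

text \<open>A partition either avoids \<open>a\<close>, or arises from a partition of
  \<open>n - a\<close> by adding one copy of \<open>a\<close>.\<close>

lemma partition_fps_insert:
  assumes "finite S" "0 \<notin> S" "0 < a" "a \<notin> S"
  shows "partition_fps (insert a S) * (1 - fps_X ^ a) = partition_fps S"
proof (rule fps_ext)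
  fix n
  define P where "P = (\<lambda>S n. {M :: nat multiset. set_mset M \<subseteq> S \<and> sum_mset M = n})"
  have fin: "finite (P (insert a S) n)" for n
    unfolding P_def using assms by (intro finite_partitions) auto
  have split: "P (insert a S) n = P S n \<union> {M \<in> P (insert a S) n. a \<in># M}"
    by (auto simp: P_def)
  have "card (P (insert a S) n) = card (P S n) + card {M \<in> P (insert a S) n. a \<in># M}"
  proof (subst split, rule card_Un_disjoint)
    show "finite (P S n)" by (rule finite_subset[OF _ fin[of n]]) (auto simp: P_def)
    show "finite {M \<in> P (insert a S) n. a \<in># M}" by (rule finite_subset[OF _ fin[of n]]) auto
    show "P S n \<inter> {M \<in> P (insert a S) n. a \<in># M} = {}" using assms(4) by (auto simp: P_def)
  qed
  moreover have "card {M \<in> P (insert a S) n. a \<in># M} = (if n < a then 0 else card (P (insert a S) (n - a)))"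
  proof (cases "n < a")
    case True
    then have "{M \<in> P (insert a S) n. a \<in># M} = {}"
      by (auto simp: P_def dest!: multi_member_split)
    then have "card {M \<in> P (insert a S) n. a \<in># M} = 0" by (simp only: card.empty)
    then show ?thesis using True by simp
  next
    case False
    have "bij_betw (\<lambda>M. M - {#a#}) {M \<in> P (insert a S) n. a \<in># M} (P (insert a S) (n - a))"
    proof (rule bij_betw_byWitness[where f' = "add_mset a"])
      show "(\<lambda>M. M - {#a#}) ` {M \<in> P (insert a S) n. a \<in># M} \<subseteq> P (insert a S) (n - a)"
        by (auto simp: P_def dest!: multi_member_split)
      show "add_mset a ` P (insert a S) (n - a) \<subseteq> {M \<in> P (insert a S) n. a \<in># M}"
        using False by (auto simp: P_def)
    qed auto
    then show ?thesis using False by (simp add: bij_betw_same_card)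
  qed
  ultimately show "(partition_fps (insert a S) * (1 - fps_X ^ a)) $ n = partition_fps S $ n"
    unfolding P_def by (simp add: partition_fps_def right_diff_distrib fps_X_power_mult_right_nth)
qed

lemma partition_fps_mult_prod_minus:
  assumes "finite S" "0 \<notin> S"
  shows "partition_fps S * prod_minus S = 1"
  using assms
proof (induction S rule: finite_induct)
  case empty
  have "{M. set_mset M \<subseteq> {} \<and> sum_mset M = n} = (if n = 0 then {{#}} else {})" for n :: nat
    by auto
  then show ?case by (intro fps_ext) (simp add: partition_fps_def prod_minus_def)
next
  case (insert a S)
  then have "partition_fps (insert a S) * prod_minus (insert a S)
      = partition_fps (insert a S) * (1 - fps_X ^ a) * prod_minus S"
    by (simp add: prod_minus_def mult_ac)
  also have "\<dots> = 1" using insert by (simp add: partition_fps_insert)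
  finally show ?case .
qed

section \<open>Extraction of the even-indexed coefficients\<close>

definition even_part :: "int fps \<Rightarrow> int fps" where
  "even_part f = Abs_fps (\<lambda>n. f $ (2 * n))"

lemma even_part_sum: "even_part (sum f A) = (\<Sum>i\<in>A. even_part (f i))"
  by (rule fps_ext) (simp add: even_part_def fps_sum_nth)

lemma even_part_X_power: "even_part (fps_X ^ k) = (if even k then fps_X ^ (k div 2) else 0)"
proof (rule fps_ext)
  fix n
  have "2 * n = k \<longleftrightarrow> even k \<and> n = k div 2" by presburger
  then show "even_part (fps_X ^ k) $ n = (if even k then fps_X ^ (k div 2) else 0) $ n"
    by (simp add: even_part_def fps_X_power_nth)
qed

lemma even_part_cong: "fps_cong (2 * L) f g \<Longrightarrow> fps_cong L (even_part f) (even_part g)"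
  by (simp add: even_part_def fps_cong_iff_nth)

text \<open>A factor that is a series in \<open>X^2\<close> passes through the extraction, with its
  exponents halved.\<close>

lemma even_part_mult_prod_minus: "even_part (f * prod_minus ((*) 2 ` S)) = even_part f * prod_minus S"
proof -
  have step: "even_part (f * (1 - fps_X ^ (2 * k))) = even_part f * (1 - fps_X ^ k)" for f k
    by (rule fps_ext)
      (auto simp: even_part_def right_diff_distrib fps_X_power_mult_right_nth right_diff_distrib')
  have "even_part (f * (\<Prod>i\<in>S. 1 - fps_X ^ (2 * i))) = even_part f * (\<Prod>i\<in>S. 1 - fps_X ^ i)"
  proof (induction S arbitrary: f rule: infinite_finite_induct)
    case (insert k S)
    then show ?case
      using insert.IH[of "f * (1 - fps_X ^ (2 * k))"] by (simp add: step mult.assoc[symmetric])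
  qed auto
  then show ?thesis unfolding prod_minus_def by (subst prod.reindex) (auto simp: inj_on_def)
qed

text \<open>Exponents are prescribed only below \<open>L\<close>, which frees later applications
  from the progressions of length \<open>n\<close>. The condition \<open>2 * a \<noteq> s\<close>
  keeps the classes of \<open>a\<close> and \<open>s - a\<close> apart, so that one product over a
  set represents both.\<close>

lemma jacobi_triple_product_sets:
  fixes a s n L :: nat
  assumes "0 < a" "a < s" "2 * L \<le> n" "2 * a \<noteq> s" "finite S" "finite T"
    and "\<And>i. i < L \<Longrightarrow> i \<in> S \<longleftrightarrow> i mod s = a \<or> i mod s = s - a"
    and "\<And>i. i < L \<Longrightarrow> i \<in> T \<longleftrightarrow> 0 < i \<and> s dvd i"
  shows "fps_cong L (prod_plus S * prod_minus T) (\<Sum>l\<in>{- int n..int n}. fps_X ^ theta_exp a s l)"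
proof -
  define U where "U = (\<lambda>i. s * i + a) ` {..<n}"
  define V where "V = (\<lambda>i. s * i + (s - a)) ` {..<n}"
  define W where "W = (\<lambda>i. s * Suc i) ` {..<n}"
  have s: "0 < s" using assms by simp
  have mod: "(s * i + a) mod s = a" "(s * i + (s - a)) mod s = s - a" for i
    using assms by (simp_all only: mod_mult_self4 mod_less diff_less)
  have disj: "U \<inter> V = {}"
  proof -
    have "x mod s = a" if "x \<in> U" for x using that mod by (auto simp: U_def)
    moreover have "x mod s = s - a" if "x \<in> V" for x using that mod by (auto simp: V_def)
    moreover have "a \<noteq> s - a" using assms by simp
    ultimately show ?thesis by (metis disjoint_iff)
  qed
  \<comment> \<open>Progressions with \<open>n\<close> terms thus reach every exponent below
    \<open>L\<close>.\<close>
  have div: "i div s < n" if "i < L" for i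
    using that assms(3) div_le_dividend[of i s] by linarith
  have "prod_plus (U \<union> V) = (\<Prod>i\<in>U. 1 + fps_X ^ i) * (\<Prod>i\<in>V. 1 + fps_X ^ i)"
    unfolding prod_plus_def by (rule prod.union_disjoint) (auto simp: U_def V_def disj[unfolded U_def V_def])
  also have "\<dots> = (\<Prod>i<n. (1 + fps_X ^ (s * i + a)) * (1 + fps_X ^ (s * i + (s - a))))"
    unfolding U_def V_def prod.distrib using s by (simp add: prod.reindex inj_on_def)
  finally have UV: "prod_plus (U \<union> V) = \<dots>" .
  have W: "prod_minus W = q_fact (fps_X ^ s) n"
    unfolding W_def q_fact_def prod_minus_def using s
    by (subst prod.reindex) (auto simp: inj_on_def power_mult[symmetric] power_add[symmetric])
  have "fps_cong L (prod_plus S * prod_minus T) (prod_plus (U \<union> V) * prod_minus W)"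
  proof (intro fps_cong_mult prod_plus_cong prod_minus_cong assms)
    fix i assume i: "i < L"
    have "i = s * (i div s) + i mod s" by simp
    then show "i \<in> S \<longleftrightarrow> i \<in> U \<union> V"
      unfolding assms(7)[OF i] U_def V_def using div[OF i] mod by (fastforce simp: image_iff)
    show "i \<in> T \<longleftrightarrow> i \<in> W"
      unfolding assms(8)[OF i] W_def
    proof
      assume "0 < i \<and> s dvd i"
      then obtain c where c: "i = s * Suc c" by (metis dvdE mult_0_right not0_implies_Suc not_gr0)
      then have "c < i" using s by (cases s) auto
      then show "i \<in> (\<lambda>i. s * Suc i) ` {..<n}" using c i assms(3) by auto
    qed (use s in auto)
  qed (auto simp: U_def V_def W_def)
  also have "fps_cong L (prod_plus (U \<union> V) * prod_minus W) (\<Sum>l\<in>{- int n..int n}. fps_X ^ theta_exp a s l)"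
    unfolding UV W by (rule jacobi_triple_product_cong) (use assms in auto)
  finally show ?thesis .
qed

section \<open>The generating functions of G and H\<close>

text \<open>\<open>theta_exp 1 4 l\<close> has the parity of \<open>l\<close>, and at
  \<open>l = 2 * m\<close> it is twice \<open>theta_exp 3 8 m\<close>; the summation range halves
  accordingly.\<close>

lemma even_part_theta:
  "even_part (\<Sum>l\<in>{- int (2 * n)..int (2 * n)}. fps_X ^ theta_exp 1 4 l) =
    (\<Sum>l\<in>{- int n..int n}. fps_X ^ theta_exp 3 8 l)"
proof -
  have th: "int (theta_exp 1 4 l) = l + 2 * (l * (l - 1))" for l
    using two_theta_exp[of 1 4 l] by simp
  have "even (theta_exp 1 4 l) \<longleftrightarrow> even l" for l
  proof -
    have "even (int (theta_exp 1 4 l)) \<longleftrightarrow> even l" unfolding th by simp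
    then show ?thesis by simp
  qed
  then have "even_part (\<Sum>l\<in>{- int (2 * n)..int (2 * n)}. fps_X ^ theta_exp 1 4 l)
      = (\<Sum>l\<in>{- int (2 * n)..int (2 * n)}. if even l then fps_X ^ (theta_exp 1 4 l div 2) else 0)"
    unfolding even_part_sum even_part_X_power by (intro sum.cong refl) simp
  also have "\<dots> = (\<Sum>l\<in>{l \<in> {- int (2 * n)..int (2 * n)}. even l}. fps_X ^ (theta_exp 1 4 l div 2))"
    by (rule sum.inter_filter[symmetric]) simp
  also have "\<dots> = (\<Sum>l\<in>{- int n..int n}. fps_X ^ theta_exp 3 8 l)"
  proof (rule sum.reindex_bij_witness[of _ "\<lambda>l. 2 * l" "\<lambda>l. l div 2"])
    fix l :: int
    assume "l \<in> {l \<in> {- int (2 * n)..int (2 * n)}. even l}"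
    then obtain m where m: "l = 2 * m" by (auto elim: evenE)
    have "int (theta_exp 1 4 l) = 2 * int (theta_exp 3 8 m)"
      unfolding th m using two_theta_exp[of 3 8 m] by (simp add: algebra_simps)
    then show "fps_X ^ theta_exp 3 8 (l div 2) = (fps_X ^ (theta_exp 1 4 l div 2) :: int fps)"
      unfolding m by simp
  qed auto
  finally show ?thesis .
qed

text \<open>Extraction halves the precision, so the first triple product is taken modulo
  \<open>X^(2 * L)\<close>. Its classes 1 and 3 modulo 4 are the odd numbers, and its multiples of 4
  are the doubled even numbers.\<close>

lemma even_part_odd_product_cong:
  "fps_cong L (even_part (prod_plus {i. i < 2 * L \<and> odd i}) * prod_minus {i. 0 < i \<and> i < L \<and> even i})
    (prod_plus {i. i < L \<and> i mod 8 \<in> {3, 5}} * prod_minus {i. 0 < i \<and> i < L \<and> 8 dvd i})"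
proof -
  have fin: "finite {i. i < 2 * L \<and> odd i}" by simp
  have "fps_cong L (even_part (prod_plus {i. i < 2 * L \<and> odd i} * prod_minus ((*) 2 ` {i. 0 < i \<and> i < L \<and> even i})))
      (even_part (\<Sum>l\<in>{- int (2 * (2 * L))..int (2 * (2 * L))}. fps_X ^ theta_exp 1 4 l))"
  proof (intro even_part_cong jacobi_triple_product_sets fin)
    fix i :: nat assume i: "i < 2 * L"
    show "i \<in> {i. i < 2 * L \<and> odd i} \<longleftrightarrow> i mod 4 = 1 \<or> i mod 4 = 4 - 1"
      using i by simp presburger
    show "i \<in> (*) 2 ` {i. 0 < i \<and> i < L \<and> even i} \<longleftrightarrow> 0 < i \<and> 4 dvd i"
    proof
      assume "0 < i \<and> 4 dvd i"
      then obtain c where "i = 4 * c" "0 < c" by (auto elim: dvdE)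
      then show "i \<in> (*) 2 ` {i. 0 < i \<and> i < L \<and> even i}"
        using i by (intro image_eqI[of _ _ "2 * c"]) auto
    qed (auto elim!: evenE)
  qed auto
  also have "even_part (\<Sum>l\<in>{- int (2 * (2 * L))..int (2 * (2 * L))}. fps_X ^ theta_exp 1 4 l)
      = (\<Sum>l\<in>{- int (2 * L)..int (2 * L)}. fps_X ^ theta_exp 3 8 l)"
    by (rule even_part_theta)
  also have "fps_cong L \<dots> (prod_plus {i. i < L \<and> i mod 8 \<in> {3, 5}} * prod_minus {i. 0 < i \<and> i < L \<and> 8 dvd i})"
    by (rule fps_cong_sym, rule jacobi_triple_product_sets) auto
  finally show ?thesis by (simp only: even_part_mult_prod_minus)
qed

lemma even_part_odd_product_inverse_cong:
  "fps_cong L (even_part (prod_plus {i. i < 2 * L \<and> odd i}) *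
    prod_minus {i. i < L \<and> i mod 16 \<in> {2, 3, 4, 5, 11, 12, 13, 14}}) 1"
proof -
  define D where "D = even_part (prod_plus {i. i < 2 * L \<and> odd i})"
  define A where "A = {i. i < L \<and> i mod 16 \<in> {2, 3, 4, 5, 11, 12, 13, 14}}"
  define B where "B = {i. 0 < i \<and> i < L \<and> i mod 16 \<in> {0, 6, 8, 10}}"
  define S where "S = {i. i < L \<and> i mod 8 \<in> {3, 5}}"
  define E where "E = {i. 0 < i \<and> i < L \<and> even i}"
  define T where "T = {i. 0 < i \<and> i < L \<and> 8 dvd i}"
  have fin: "finite A" "finite B" "finite S" "finite E" "finite T"
    by (simp_all add: A_def B_def S_def E_def T_def)
  have "E \<union> S = A \<union> B"
  proof -
    \<comment> \<open>Everything depends on residues modulo 16 only, which leaves a finite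
      check.\<close>
    have "\<forall>r\<in>{..<16::nat}. even r \<or> r mod 8 \<in> {3, 5} \<longleftrightarrow>
        r \<in> {2, 3, 4, 5, 11, 12, 13, 14} \<or> r \<in> {0, 6, 8, 10}"
      by code_simp
    moreover have "i mod 16 mod 8 = i mod 8" "even (i mod 16) \<longleftrightarrow> even i" "i mod 16 \<in> {..<16}" for i :: nat
      by (simp_all add: mod_mod_cancel dvd_mod_iff)
    ultimately have "even i \<or> i mod 8 \<in> {3, 5} \<longleftrightarrow>
        i mod 16 \<in> {2, 3, 4, 5, 11, 12, 13, 14} \<or> i mod 16 \<in> {0, 6, 8, 10}" for i :: nat
      by metis
    moreover have "0 < i" if "i mod 8 \<in> {3, 5} \<or> i mod 16 \<in> {2, 3, 4, 5, 11, 12, 13, 14}" for i :: nat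
      using that by (cases i) auto
    ultimately show ?thesis
      unfolding A_def B_def S_def E_def by (simp only: set_eq_iff Un_iff mem_Collect_eq) metis
  qed
  moreover have "E \<inter> S = {}" unfolding E_def S_def by (auto; presburger)
  moreover have "A \<inter> B = {}" unfolding A_def B_def by auto
  ultimately have AB: "prod_minus E * prod_minus S = prod_minus A * prod_minus B"
    using fin by (metis prod_minus_Un)
  have "fps_cong L (D * prod_minus E * prod_minus S) (prod_plus S * prod_minus T * prod_minus S)"
    unfolding D_def E_def S_def T_def by (intro fps_cong_mult even_part_odd_product_cong fps_cong_refl)
  also have "prod_plus S * prod_minus T * prod_minus S = prod_minus ((*) 2 ` S) * prod_minus T"
    unfolding prod_plus_mult_prod_minus[symmetric] by (simp only: mult_ac)
  also have "\<dots> = prod_minus ((*) 2 ` S \<union> T)"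
  proof (rule prod_minus_Un[symmetric])
    show "(*) 2 ` S \<inter> T = {}" unfolding S_def T_def by (auto; presburger)
  qed (use fin in auto)
  \<comment> \<open>Doubling sends the classes 3 and 5 modulo 8 to 6 and 10 modulo 16, and
    \<open>T\<close> supplies 0 and 8. Doubled elements may exceed \<open>L\<close>, so the sets
    agree only below \<open>L\<close>.\<close>
  also have "fps_cong L \<dots> (1 * prod_minus B)"
    unfolding mult_1
  proof (rule prod_minus_cong)
    fix i assume i: "i < L"
    have double: "2 * x mod 16 = 2 * (x mod 8)" for x :: nat
      using mod_mult_mult1[of 2 x 8] by simp
    have "i \<in> (*) 2 ` S \<longleftrightarrow> i mod 16 \<in> {6, 10}"
    proof
      assume *: "i mod 16 \<in> {6, 10}"
      then have "even (i mod 16)" by auto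
      then have "even i" by (simp add: dvd_mod_iff)
      then obtain x where x: "i = 2 * x" by (rule evenE)
      have "x \<in> S" using * i unfolding x double S_def by simp
      then show "i \<in> (*) 2 ` S" unfolding x by (rule imageI)
    next
      assume "i \<in> (*) 2 ` S"
      then show "i mod 16 \<in> {6, 10}" unfolding S_def by (auto simp: double)
    qed
    moreover have "8 dvd i \<longleftrightarrow> i mod 16 \<in> {0, 8}"
    proof -
      have "\<forall>r\<in>{..<16::nat}. 8 dvd r \<longleftrightarrow> r \<in> {0, 8}" by code_simp
      moreover have "i mod 16 \<in> {..<16}" by simp
      ultimately have "8 dvd i mod 16 \<longleftrightarrow> i mod 16 \<in> {0, 8}" by (rule bspec)
      moreover have "8 dvd i mod 16 \<longleftrightarrow> 8 dvd i" by (rule dvd_mod_iff) simp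
      ultimately show ?thesis by (simp only:)
    qed
    ultimately show "i \<in> (*) 2 ` S \<union> T \<longleftrightarrow> i \<in> B" using i by (auto simp: T_def B_def)
  qed (use fin in auto)
  finally have "fps_cong L (D * prod_minus A * prod_minus B) (1 * prod_minus B)"
    by (simp add: mult.assoc AB)
  then show ?thesis
    unfolding A_def[symmetric] D_def[symmetric]
    by (rule fps_cong_cancel) (simp add: prod_minus_nth_0 B_def)
qed

text \<open>A member of a set with sum \<open>2 * n\<close> is at most \<open>2 * n\<close>, so
  cutting off at \<open>2 * L\<close> loses nothing.\<close>

lemma H_eq_even_part_nth:
  assumes "n < L"
  shows "int (H n) = even_part (prod_plus {i. i < 2 * L \<and> odd i}) $ n"
proof -
  have "{T. finite T \<and> (\<forall>t\<in>T. odd t) \<and> \<Sum>T = 2 * n}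
      = {T. T \<subseteq> {i. i < 2 * L \<and> odd i} \<and> \<Sum>T = 2 * n}"
  proof -
    have "t < 2 * L" if "finite T" "t \<in> T" "\<Sum>T = 2 * n" for t and T :: "nat set"
      using member_le_sum[of t T "\<lambda>x. x"] that assms by simp
    then show ?thesis by (auto intro: finite_subset[of _ "{i. i < 2 * L \<and> odd i}"])
  qed
  then show ?thesis by (simp add: H_eq_card_odd_sets even_part_def prod_plus_nth)
qed

lemma G_eq_partition_fps_nth:
  assumes "n < L"
  shows "int (G n) = partition_fps {i. i < L \<and> i mod 16 \<in> {2, 3, 4, 5, 11, 12, 13, 14}} $ n"
proof -
  have "{M :: nat multiset. (\<forall>p \<in># M. p > 0 \<and> p mod 16 \<in> {2,3,4,5,11,12,13,14}) \<and> sum_mset M = n}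
      = {M. set_mset M \<subseteq> {i. i < L \<and> i mod 16 \<in> {2, 3, 4, 5, 11, 12, 13, 14}} \<and> sum_mset M = n}"
  proof -
    have "p < L" if "p \<in># M" "sum_mset M = n" for p and M :: "nat multiset"
      using that assms by (auto dest!: multi_member_split)
    moreover have "p > 0" if "p mod 16 \<in> {2, 3, 4, 5, 11, 12, 13, 14}" for p :: nat
      using that by (cases p) auto
    ultimately show ?thesis by blast
  qed
  then show ?thesis by (simp add: G_def partition_fps_def)
qed

theorem theorem31:
  fixes n :: nat
  assumes "n \<ge> 1"
  shows "G n = H n"
proof -
  \<comment> \<open>\<open>Suc n\<close> is the least precision at which the coefficient of index
    \<open>n\<close> is visible.\<close>
  define A where "A = {i. i < Suc n \<and> i mod 16 \<in> {2, 3, 4, 5, 11, 12, 13, 14}}"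
  define D where "D = even_part (prod_plus {i. i < 2 * Suc n \<and> odd i})"
  have "0 \<notin> A" "finite A" by (auto simp: A_def)
  then have "fps_cong (Suc n) (D * prod_minus A) (partition_fps A * prod_minus A)"
    unfolding partition_fps_mult_prod_minus[OF \<open>finite A\<close> \<open>0 \<notin> A\<close>]
    unfolding A_def D_def by (intro even_part_odd_product_inverse_cong)
  then have "fps_cong (Suc n) D (partition_fps A)"
    using \<open>0 \<notin> A\<close> by (rule fps_cong_cancel[OF _ prod_minus_nth_0])
  then have "int (H n) = int (G n)"
    unfolding A_def D_def fps_cong_iff_nth
    by (simp only: H_eq_even_part_nth[OF lessI] G_eq_partition_fps_nth[OF lessI] lessI)
  then show ?thesis by simp
qed

end
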